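(* Let $k\ge 2$ and let $f\in L^1(\mathbb{N})$ be a $k$-monotone sequence. The following two assertions are equivalent: (1) for all $l\in\mathbb{N}$, $F^k_f(l)\ge F^k_{\tilde p}(l)$, and if $l$ is a $k$-knot of $f$ this inequality is an equality; (2) $f=\hat p^{*}$.
   Context: $\mathbb{N}=\{0,1,2,\dots\}$; $L^1(\mathbb{N})$ is the set of absolutely summable sequences. For a real sequence $f=(f(i))_{i\in\mathbb{N}}$, put $\Delta^1 f(i)=f(i+1)-f(i)$ and $\Delta^{k}f(i)=\Delta^{k-1}f(i+1)-\Delta^{k-1}f(i)$. The sequence $f$ is $k$-monotone if $(-1)^k\Delta^k f(i)\ge 0$ for all $i\in\mathbb{N}$; a $k$-knot of a $k$-monotone $f$ is an integer $i\in\mathbb{N}$ with $(-1)^k\Delta^k f(i)>0$. $\mathcal{S}^k$ is the set of $k$-monotone sequences in $L^1(\mathbb{N})$. $X_1,\dots,X_n$ are $n\ge 1$ i.i.d. observations in $\mathbb{N}$, $\tilde p(j)=\frac1n\sum_{i=1}^n \mathbb{I}_{\{X_i=j\}}$ is the empirical probability mass function, and $\hat p^{*}=\operatorname{argmin}\{\|f-\tilde p\|_2^2 : f\in\mathcal{S}^k\}$, where $\|g\|_2^2=\sum_{i\ge 0}g(i)^2$ (this minimizer exists and is unique). Iterated primitives: $F^1_f(l)=\sum_{i=0}^l f(i)$ and $F^j_f(l)=\sum_{i=0}^l F^{j-1}_f(i)$ for $j\ge 2$. *)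

theory Defs
  imports "HOL-Probability.Probability"
begin

definition L1 :: "(nat \<Rightarrow> real) set" where
  "L1 = {f. summable (\<lambda>i. \<bar>f i\<bar>)}"

text \<open>Both iterated operators are started at order \<open>0\<close> with the sequence itself, so that their
  first iterates are the usual forward difference and the usual partial sums.\<close>

primrec fdiff :: "nat \<Rightarrow> (nat \<Rightarrow> real) \<Rightarrow> nat \<Rightarrow> real" where
  "fdiff 0 f i = f i"
| "fdiff (Suc k) f i = fdiff k f (i + 1) - fdiff k f i"

primrec primitive :: "nat \<Rightarrow> (nat \<Rightarrow> real) \<Rightarrow> nat \<Rightarrow> real" where
  "primitive 0 f l = f l"
| "primitive (Suc j) f l = (\<Sum>i=0..l. primitive j f i)"

definition k_monotone :: "nat \<Rightarrow> (nat \<Rightarrow> real) \<Rightarrow> bool" where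
  "k_monotone k f \<longleftrightarrow> (\<forall>i. (-1) ^ k * fdiff k f i \<ge> 0)"

definition k_knot :: "nat \<Rightarrow> (nat \<Rightarrow> real) \<Rightarrow> nat \<Rightarrow> bool" where
  "k_knot k f i \<longleftrightarrow> (-1) ^ k * fdiff k f i > 0"

definition k_monotone_L1 :: "nat \<Rightarrow> (nat \<Rightarrow> real) set" where
  "k_monotone_L1 k = {f \<in> L1. k_monotone k f}"

text \<open>A sample of size \<open>n\<close> is given by the values \<open>x 1, \<dots>, x n\<close>.\<close>

definition empirical_pmf :: "nat \<Rightarrow> (nat \<Rightarrow> nat) \<Rightarrow> nat \<Rightarrow> real" where
  "empirical_pmf n x j = (1 / real n) * (\<Sum>i=1..n. of_bool (x i = j))"

text \<open>Only meaningful for square-summable \<open>g\<close>. It is applied below to differences of sequences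
  in \<open>L1\<close>, which are square-summable.\<close>

definition sq_norm2 :: "(nat \<Rightarrow> real) \<Rightarrow> real" where
  "sq_norm2 g = (\<Sum>i. (g i)\<^sup>2)"

definition LS_estimator :: "nat \<Rightarrow> nat \<Rightarrow> (nat \<Rightarrow> nat) \<Rightarrow> nat \<Rightarrow> real" where
  "LS_estimator k n x =
     arg_min (\<lambda>f. sq_norm2 (\<lambda>i. f i - empirical_pmf n x i)) (\<lambda>f. f \<in> k_monotone_L1 k)"

end

(*
Write g = f - p with p the empirical mass function. Repeated summation by parts turns the inner product of g with a
k-monotone h vanishing at infinity into the sum over l of (-1)^k Delta^k h(l) * F^k_g(l). So (1) says that
<g,h> \<ge> 0 for all h in the cone and <g,f> = 0, which characterises the projection onto a convex cone.

For the converse a minimiser satisfying (1) must exist. The l2-norm is minimised over the k-monotone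
square-summable sequences, where a minimising sequence is Cauchy by the parallelogram law. Perturbing
the minimiser f by the sequence whose k-th difference is concentrated at l gives (1) for f. If f had no
zero, then g would be eventually positive, so each iterated primitive of g would eventually have a
strict sign; the k-knots of f, being zeros of F^k_g, would be finite in number, forcing f to vanish
eventually. Hence f has finite support, and in particular lies in L1.
*)
theory Submission
  imports Defs
begin

section \<open>Signed iterated differences\<close>

definition adiff :: "nat \<Rightarrow> (nat \<Rightarrow> real) \<Rightarrow> nat \<Rightarrow> real" where
  "adiff k f i = (-1) ^ k * fdiff k f i"

lemma adiff_0 [simp]: "adiff 0 f = f"
  by (simp add: adiff_def fun_eq_iff)

text \<open>With the sign absorbed, nonnegativity at order \<open>Suc k\<close> says exactly that
  order \<open>k\<close> is decreasing.\<close>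

lemma adiff_Suc: "adiff (Suc k) f i = adiff k f i - adiff k f (Suc i)"
  by (simp add: adiff_def algebra_simps)

lemma k_monotone_iff_adiff: "k_monotone k f \<longleftrightarrow> (\<forall>i. adiff k f i \<ge> 0)"
  by (simp add: k_monotone_def adiff_def)

lemma k_knot_iff_adiff: "k_knot k f i \<longleftrightarrow> adiff k f i > 0"
  by (simp add: k_knot_def adiff_def)

lemma adiff_add_scaled: "adiff k (\<lambda>i. f i + c * h i) i = adiff k f i + c * adiff k h i"
  by (induction k arbitrary: i) (simp_all add: adiff_Suc algebra_simps)

lemma adiff_zero: "adiff k (\<lambda>i. 0) i = 0"
  by (induction k arbitrary: i) (simp_all add: adiff_Suc)

lemma tendsto_adiff:
  assumes "\<And>i. (\<lambda>m. F m i) \<longlonglongrightarrow> f i"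
  shows "(\<lambda>m. adiff k (F m) i) \<longlonglongrightarrow> adiff k f i"
  by (induction k arbitrary: i) (auto simp: adiff_Suc assms intro: tendsto_diff)

lemma adiff_tendsto_0:
  assumes "f \<longlonglongrightarrow> 0"
  shows "adiff k f \<longlonglongrightarrow> 0"
proof (induction k)
  case (Suc k)
  have "(\<lambda>i. adiff k f i - adiff k f (Suc i)) \<longlonglongrightarrow> 0 - 0"
    by (intro tendsto_diff Suc LIMSEQ_Suc)
  then show ?case
    by (simp add: adiff_Suc [abs_def])
qed (use assms in simp)

text \<open>Downward induction on the order: nonnegativity at order \<open>Suc j\<close> makes order
  \<open>j\<close> decreasing, and a decreasing sequence with limit 0 is nonnegative.\<close>

lemma adiff_nonneg:
  assumes "k_monotone k f" "f \<longlonglongrightarrow> 0" "j \<le> k"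
  shows "adiff j f i \<ge> 0"
  using \<open>j \<le> k\<close>
proof (induction j arbitrary: i rule: inc_induct)
  case base
  then show ?case
    using assms(1) by (simp add: k_monotone_iff_adiff)
next
  case (step j)
  have "decseq (adiff j f)"
    using step.IH by (simp add: decseq_Suc_iff adiff_Suc)
  then show ?case
    using adiff_tendsto_0 [OF assms(2)] decseq_ge by blast
qed

lemma decseq_adiff:
  assumes "k_monotone k f" "f \<longlonglongrightarrow> 0" "j < k"
  shows "decseq (adiff j f)"
  using adiff_nonneg [OF assms(1,2), of "Suc j"] assms(3)
  by (simp add: decseq_Suc_iff adiff_Suc Suc_le_eq)

text \<open>If order \<open>Suc k\<close> vanishes from \<open>N\<close> on, order \<open>k\<close>
  is constant there, and its limit 0 forces that constant to be 0. The threshold \<open>N\<close>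
  does not move as the order goes down.\<close>

lemma eventually_zero_of_adiff:
  assumes "f \<longlonglongrightarrow> 0" "\<And>i. i \<ge> N \<Longrightarrow> adiff k f i = 0" "i \<ge> N"
  shows "f i = 0"
  using assms(2)
proof (induction k)
  case (Suc k)
  have step: "adiff k f (Suc i) = adiff k f i" if "i \<ge> N" for i
    using Suc.prems [OF that] unfolding adiff_Suc by simp
  have "adiff k f i = 0" if "i \<ge> N" for i
  proof -
    have "adiff k f (i + m) = adiff k f i" for m
      using that by (induction m) (simp_all add: step)
    then have "(\<lambda>m. adiff k f (m + i)) \<longlonglongrightarrow> adiff k f i"
      by (simp add: add.commute)
    then show ?thesis
      using LIMSEQ_ignore_initial_segment [OF adiff_tendsto_0 [OF assms(1)]] LIMSEQ_unique by blast
  qed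
  then show ?case
    by (rule Suc.IH)
qed (use assms(3) in simp)

text \<open>Tail sums invert one signed difference and keep the support inside
  \<open>{0..l}\<close>. With \<open>v\<close> the indicator of \<open>l\<close> this yields the
  perturbation directions.\<close>

lemma exists_adiff_eq:
  assumes "\<And>i. i > l \<Longrightarrow> v i = 0"
  shows "\<exists>h. (\<forall>i>l. h i = 0) \<and> adiff k h = v"
  using assms
proof (induction k arbitrary: v)
  case (Suc k)
  let ?w = "\<lambda>i. \<Sum>m\<in>{i..l}. v m"
  obtain h where h: "\<forall>i>l. h i = 0" "adiff k h = ?w"
    using Suc.IH [of ?w] by auto
  have "adiff (Suc k) h i = v i" for i
  proof (cases "i \<le> l")
    case True
    then show ?thesis
      by (simp add: adiff_Suc h(2) sum.atLeast_Suc_atMost)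
  qed (simp add: adiff_Suc h(2) Suc.prems)
  with h(1) show ?case
    by blast
qed auto

section \<open>Iterated primitives and their eventual sign\<close>

lemma primitive_diff: "primitive k (\<lambda>i. f i - h i) l = primitive k f l - primitive k h l"
  by (induction k arbitrary: l) (simp_all add: sum_subtractf)

lemma abs_primitive_le: "\<bar>primitive k g l\<bar> \<le> primitive k (\<lambda>i. \<bar>g i\<bar>) l"
proof (induction k arbitrary: l)
  case (Suc k)
  have "\<bar>\<Sum>i=0..l. primitive k g i\<bar> \<le> (\<Sum>i=0..l. \<bar>primitive k g i\<bar>)"
    by (rule sum_abs)
  also have "\<dots> \<le> (\<Sum>i=0..l. primitive k (\<lambda>i. \<bar>g i\<bar>) i)"
    by (intro sum_mono Suc)
  finally show ?case
    by simp
qed simp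

text \<open>Beyond \<open>N\<close> the partial sums increase strictly, so they either reach a
  nonnegative value and are positive afterwards, or stay negative. Early negative terms can make the
  second case occur.\<close>

lemma partial_sums_eventually_pos_or_neg:
  fixes u :: "nat \<Rightarrow> real"
  assumes "\<And>i. i \<ge> N \<Longrightarrow> u i > 0"
  shows "\<exists>M. (\<forall>i\<ge>M. sum u {0..i} > 0) \<or> (\<forall>i\<ge>M. sum u {0..i} < 0)"
proof (cases "\<exists>M\<ge>N. sum u {0..M} \<ge> 0")
  case True
  then obtain M where M: "M \<ge> N" "sum u {0..M} \<ge> 0"
    by blast
  have "sum u {0..i} > 0" if "i \<ge> Suc M" for i
    using that
  proof (induction i rule: dec_induct)
    case base
    then show ?case
      using M assms [of "Suc M"] by simp
  next
    case (step i)
    then show ?case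
      using M assms [of "Suc i"] by simp
  qed
  then show ?thesis
    by blast
next
  case False
  then show ?thesis
    by (meson not_le)
qed

lemma primitive_eventually_pos_or_neg:
  assumes "\<And>i. i \<ge> N \<Longrightarrow> g i > 0"
  shows "\<exists>M. (\<forall>i\<ge>M. primitive k g i > 0) \<or> (\<forall>i\<ge>M. primitive k g i < 0)"
proof (induction k)
  case (Suc k)
  then obtain M where "(\<forall>i\<ge>M. primitive k g i > 0) \<or> (\<forall>i\<ge>M. primitive k g i < 0)"
    by blast
  then show ?case
  proof
    assume "\<forall>i\<ge>M. primitive k g i > 0"
    then show ?thesis
      using partial_sums_eventually_pos_or_neg [of M "primitive k g"] by simp
  next
    assume "\<forall>i\<ge>M. primitive k g i < 0"
    then show ?thesis
      using partial_sums_eventually_pos_or_neg [of M "\<lambda>i. - primitive k g i"]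
      by (auto simp: sum_negf)
  qed
qed (use assms in auto)

section \<open>Iterated summation by parts\<close>

lemma decseq_mult_partial_sums_tendsto_0:
  fixes u G :: "nat \<Rightarrow> real"
  assumes "decseq u" "u \<longlonglongrightarrow> 0" "\<And>i. G i \<ge> 0" "summable (\<lambda>i. u i * G i)"
  shows "(\<lambda>N. u N * (\<Sum>i=0..N. G i)) \<longlonglongrightarrow> 0"
proof (rule LIMSEQ_I)
  fix e :: real
  assume "e > 0"
  have u: "u i \<ge> 0" for i
    using decseq_ge [OF assms(1,2)] .
  \<comment> \<open>Beyond \<open>M\<close> every block of the series is below \<open>e / 2\<close>.
    As \<open>u\<close> decreases, \<open>u N\<close> times a block of \<open>G\<close> up to
    \<open>N\<close> is bounded by the corresponding block of the series; the head below
    \<open>M\<close> is a fixed number, multiplied by \<open>u N\<close>, which tends to 0.\<close>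
  obtain M where M: "\<And>n. norm (\<Sum>i=M..<n. u i * G i) < e / 2"
    using assms(4) \<open>e > 0\<close> unfolding summable_Cauchy
    by (metis half_gt_zero order_refl)
  have "(\<lambda>N. u N * (\<Sum>i<M. G i)) \<longlonglongrightarrow> 0"
    using assms(2) by (intro tendsto_mult_left_zero)
  then obtain K where K: "\<And>N. N \<ge> K \<Longrightarrow> norm (u N * (\<Sum>i<M. G i) - 0) < e / 2"
    using \<open>e > 0\<close> LIMSEQ_D half_gt_zero by blast
  show "\<exists>K. \<forall>N\<ge>K. norm (u N * (\<Sum>i=0..N. G i) - 0) < e"
  proof (intro exI allI impI)
    fix N
    assume N: "N \<ge> max K M"
    have "{0..N} = {..<M} \<union> {M..<Suc N}"
      using N by auto
    then have "u N * (\<Sum>i=0..N. G i) = u N * (\<Sum>i<M. G i) + (\<Sum>i=M..<Suc N. u N * G i)"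
      by (simp add: sum.union_disjoint ivl_disj_int distrib_left sum_distrib_left
          del: sum.op_ivl_Suc)
    also have "(\<Sum>i=M..<Suc N. u N * G i) \<le> (\<Sum>i=M..<Suc N. u i * G i)"
      by (intro sum_mono mult_right_mono) (auto intro: decseqD [OF assms(1)] assms(3))
    also have "\<dots> < e / 2"
      using M [of "Suc N"] by (simp del: sum.op_ivl_Suc)
    also have "u N * (\<Sum>i<M. G i) < e / 2"
      using K [of N] N by simp
    finally have "u N * (\<Sum>i=0..N. G i) < e"
      by simp
    moreover have "u N * (\<Sum>i=0..N. G i) \<ge> 0"
      by (intro mult_nonneg_nonneg sum_nonneg u assms)
    ultimately show "norm (u N * (\<Sum>i=0..N. G i) - 0) < e"
      by simp
  qed
qed

text \<open>Abel summation. The right-hand sum has one term more because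
  \<open>primitive (Suc j) g N\<close> includes index \<open>N\<close>.\<close>

lemma sum_by_parts_primitive:
  "(\<Sum>i<N. adiff (Suc j) h i * primitive (Suc j) g i)
     = (\<Sum>i<Suc N. adiff j h i * primitive j g i) - adiff j h N * primitive (Suc j) g N"
proof (induction N)
  case (Suc N)
  then show ?case
    by (simp add: adiff_Suc algebra_simps)
qed simp

lemma sums_by_parts_primitive:
  assumes "(\<lambda>i. adiff j h i * primitive j g i) sums c"
    and "(\<lambda>N. adiff j h N * primitive (Suc j) g N) \<longlonglongrightarrow> 0"
  shows "(\<lambda>i. adiff (Suc j) h i * primitive (Suc j) g i) sums c"
proof -
  have "(\<lambda>N. (\<Sum>i<Suc N. adiff j h i * primitive j g i) - adiff j h N * primitive (Suc j) g N)
          \<longlonglongrightarrow> c - 0"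
    using assms by (intro tendsto_diff LIMSEQ_Suc) (simp_all add: sums_def)
  then show ?thesis
    unfolding sums_def sum_by_parts_primitive by simp
qed

lemma iterated_sums_by_parts:
  assumes h: "k_monotone k h" "h \<longlonglongrightarrow> 0"
    and sm: "summable (\<lambda>i. h i * \<bar>g i\<bar>)" and sg: "(\<lambda>i. h i * g i) sums c"
  shows "(\<lambda>i. adiff k h i * primitive k g i) sums c"
proof -
  \<comment> \<open>The induction carries the same series for the absolute values of
    \<open>g\<close>: its terms are nonnegative, so its boundary term tends to 0, and that boundary
    term dominates the one for \<open>g\<close>.\<close>
  have "summable (\<lambda>i. adiff j h i * primitive j (\<lambda>i. \<bar>g i\<bar>) i) \<and>
        (\<lambda>i. adiff j h i * primitive j g i) sums c" if "j \<le> k" for j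
    using that
  proof (induction j)
    case 0
    then show ?case
      using sm sg by simp
  next
    case (Suc j)
    let ?G = "\<lambda>i. \<bar>g i\<bar>"
    have IH: "summable (\<lambda>i. adiff j h i * primitive j ?G i)"
      "(\<lambda>i. adiff j h i * primitive j g i) sums c"
      using Suc by auto
    have nn: "primitive m ?G i \<ge> 0" for m i
      using abs_primitive_le [of m g i] by linarith
    have lim: "(\<lambda>N. adiff j h N * primitive (Suc j) ?G N) \<longlonglongrightarrow> 0"
      using decseq_mult_partial_sums_tendsto_0
        [OF decseq_adiff [OF h] adiff_tendsto_0 [OF h(2)] nn IH(1)] Suc.prems
      by simp
    have "(\<lambda>N. adiff j h N * primitive (Suc j) g N) \<longlonglongrightarrow> 0"
    proof (rule Lim_null_comparison [OF always_eventually lim], rule allI)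
      fix N
      show "norm (adiff j h N * primitive (Suc j) g N) \<le> adiff j h N * primitive (Suc j) ?G N"
        using adiff_nonneg [OF h, of j N] Suc.prems abs_primitive_le [of "Suc j" g N]
        by (simp add: abs_mult mult_left_mono del: primitive.simps)
    qed
    then show ?case
      using sums_by_parts_primitive [OF IH(2)]
        sums_by_parts_primitive [OF summable_sums [OF IH(1)] lim] sums_summable
      by blast
  qed
  then show ?thesis
    by simp
qed

section \<open>Square-summable sequences\<close>

lemma summable_square_of_L1:
  assumes "f \<in> L1"
  shows "summable (\<lambda>i. (f i)\<^sup>2)"
proof (rule summable_comparison_test_ev)
  have f: "summable (\<lambda>i. \<bar>f i\<bar>)"
    using assms by (simp add: L1_def)
  then show "summable (\<lambda>i. \<bar>f i\<bar>)" .
  have "(\<lambda>i. \<bar>f i\<bar>) \<longlonglongrightarrow> 0"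
    using f by (rule summable_LIMSEQ_zero)
  then have "eventually (\<lambda>i. \<bar>f i\<bar> < 1) sequentially"
    by (rule order_tendstoD) simp
  then show "eventually (\<lambda>i. norm ((f i)\<^sup>2) \<le> \<bar>f i\<bar>) sequentially"
  proof eventually_elim
    case (elim i)
    have "\<bar>f i\<bar> * \<bar>f i\<bar> \<le> 1 * \<bar>f i\<bar>"
      using elim by (intro mult_right_mono) auto
    then show ?case
      by (simp add: power2_eq_square abs_mult)
  qed
qed

lemma summable_mult_of_square:
  fixes f h :: "nat \<Rightarrow> real"
  assumes "summable (\<lambda>i. (f i)\<^sup>2)" "summable (\<lambda>i. (h i)\<^sup>2)"
  shows "summable (\<lambda>i. f i * h i)"
proof (rule summable_comparison_test_ev)
  show "summable (\<lambda>i. (f i)\<^sup>2 + (h i)\<^sup>2)"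
    using assms by (rule summable_add)
  show "eventually (\<lambda>i. norm (f i * h i) \<le> (f i)\<^sup>2 + (h i)\<^sup>2) sequentially"
  proof (rule always_eventually, rule allI)
    fix i
    have "2 * (\<bar>f i\<bar> * \<bar>h i\<bar>) \<le> (f i)\<^sup>2 + (h i)\<^sup>2"
      using sum_squares_bound [of "\<bar>f i\<bar>" "\<bar>h i\<bar>"] by (simp add: mult.assoc)
    moreover have "\<bar>f i\<bar> * \<bar>h i\<bar> \<ge> 0"
      by simp
    ultimately have "\<bar>f i\<bar> * \<bar>h i\<bar> \<le> (f i)\<^sup>2 + (h i)\<^sup>2"
      by linarith
    then show "norm (f i * h i) \<le> (f i)\<^sup>2 + (h i)\<^sup>2"
      by (simp add: abs_mult)
  qed
qed

lemma summable_square_add_scaled: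
  fixes f h :: "nat \<Rightarrow> real"
  assumes "summable (\<lambda>i. (f i)\<^sup>2)" "summable (\<lambda>i. (h i)\<^sup>2)"
  shows "summable (\<lambda>i. (f i + t * h i)\<^sup>2)"
proof -
  have "summable (\<lambda>i. (f i)\<^sup>2 + 2 * t * (f i * h i) + t\<^sup>2 * (h i)\<^sup>2)"
    by (intro summable_add summable_mult summable_mult_of_square assms)
  then show ?thesis
    by (simp add: power2_sum power_mult_distrib algebra_simps)
qed

text \<open>Expansion along a line: \<open>t = 1/2\<close> gives midpoints, \<open>t = 1\<close>
  endpoints, and variable \<open>t\<close> the perturbations of a minimiser.\<close>

lemma sq_norm2_add_scaled:
  assumes "summable (\<lambda>i. (f i)\<^sup>2)" "summable (\<lambda>i. (h i)\<^sup>2)"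
  shows "sq_norm2 (\<lambda>i. f i + t * h i) = sq_norm2 f + 2 * t * (\<Sum>i. f i * h i) + t\<^sup>2 * sq_norm2 h"
proof -
  note sm = assms summable_mult_of_square [OF assms]
  have "(\<lambda>i. (f i)\<^sup>2 + 2 * t * (f i * h i) + t\<^sup>2 * (h i)\<^sup>2)
          sums (sq_norm2 f + 2 * t * (\<Sum>i. f i * h i) + t\<^sup>2 * sq_norm2 h)"
    unfolding sq_norm2_def by (intro sums_add sums_mult summable_sums sm)
  then show ?thesis
    unfolding sq_norm2_def
    by (simp add: sums_iff power2_sum power_mult_distrib algebra_simps)
qed

lemma sq_norm2_nonneg:
  assumes "summable (\<lambda>i. (f i)\<^sup>2)"
  shows "sq_norm2 f \<ge> 0"
  unfolding sq_norm2_def by (rule suminf_nonneg [OF assms]) simp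

lemma square_le_sq_norm2:
  assumes "summable (\<lambda>i. (f i)\<^sup>2)"
  shows "(f i)\<^sup>2 \<le> sq_norm2 f"
  using sum_le_suminf [OF assms, of "{i}"] unfolding sq_norm2_def by simp

lemma tendsto_zero_of_summable_square:
  fixes f :: "nat \<Rightarrow> real"
  assumes "summable (\<lambda>i. (f i)\<^sup>2)"
  shows "f \<longlonglongrightarrow> 0"
  using summable_LIMSEQ_zero [OF assms] by simp

lemma L1_of_eventually_zero:
  assumes "\<And>i. i \<ge> N \<Longrightarrow> f i = 0"
  shows "f \<in> L1"
proof -
  have "summable (\<lambda>i. \<bar>f i\<bar>)"
    by (rule summable_finite [of "{..<N}"]) (use assms in auto)
  then show ?thesis
    by (simp add: L1_def)
qed

lemma L1_tendsto_0:
  assumes "f \<in> L1"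
  shows "f \<longlonglongrightarrow> 0"
  using assms tendsto_zero_of_summable_square summable_square_of_L1 by blast

section \<open>Existence of a minimiser among square-summable \<open>k\<close>-monotone
  sequences\<close>

definition mono_l2 :: "nat \<Rightarrow> (nat \<Rightarrow> real) set" where
  "mono_l2 k = {f. k_monotone k f \<and> summable (\<lambda>i. (f i)\<^sup>2)}"

lemma mono_l2_convex_midpoint:
  assumes "f \<in> mono_l2 k" "h \<in> mono_l2 k"
  shows "(\<lambda>i. f i + (1/2) * (h i - f i)) \<in> mono_l2 k"
proof -
  have diff: "adiff k (\<lambda>i. h i - f i) i = adiff k h i - adiff k f i" for i
    using adiff_add_scaled [of k h "-1" f i] by simp
  have "summable (\<lambda>i. (h i - f i)\<^sup>2)"
    using assms summable_square_add_scaled [of h f "-1"] by (simp add: mono_l2_def)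
  then have "summable (\<lambda>i. (f i + (1/2) * (h i - f i))\<^sup>2)"
    using assms by (intro summable_square_add_scaled) (simp_all add: mono_l2_def)
  moreover have "adiff k (\<lambda>i. f i + (1/2) * (h i - f i)) i \<ge> 0" for i
    unfolding adiff_add_scaled diff
    using assms by (simp add: mono_l2_def k_monotone_iff_adiff field_simps)
  ultimately show ?thesis
    by (simp add: mono_l2_def k_monotone_iff_adiff)
qed

text \<open>Absolute summability can be lost in an l2 limit, so the search takes place in
  \<open>mono_l2\<close>. The norm controls each coordinate, hence pointwise limits exist; each
  signed difference involves finitely many coordinates, so its sign survives.\<close>

lemma exists_minimiser_mono_l2:
  assumes p: "summable (\<lambda>i. (p i)\<^sup>2)"
  obtains f where "f \<in> mono_l2 k"
    and "\<And>h. h \<in> mono_l2 k \<Longrightarrow> sq_norm2 (\<lambda>i. f i - p i) \<le> sq_norm2 (\<lambda>i. h i - p i)"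
proof -
  let ?\<Phi> = "\<lambda>f. sq_norm2 (\<lambda>i. f i - p i)"
  define d where "d = Inf (?\<Phi> ` mono_l2 k)"
  have sm: "summable (\<lambda>i. (f i - p i)\<^sup>2)" if "f \<in> mono_l2 k" for f
    using that p summable_square_add_scaled [of f p "-1"] by (simp add: mono_l2_def)
  have ne: "mono_l2 k \<noteq> {}"
    using adiff_zero by (auto simp: mono_l2_def k_monotone_iff_adiff intro!: exI [of _ "\<lambda>_. 0"])
  have bdd: "bdd_below (?\<Phi> ` mono_l2 k)"
    using sq_norm2_nonneg [OF sm] by (auto intro!: bdd_belowI [of _ 0])
  have d_le: "d \<le> ?\<Phi> f" if "f \<in> mono_l2 k" for f
    unfolding d_def using that bdd by (intro cInf_lower) auto
  have "\<exists>f\<in>mono_l2 k. ?\<Phi> f < d + 1 / real (Suc m)" for m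
    using cInf_lessD [of "?\<Phi> ` mono_l2 k" "d + 1 / real (Suc m)"] ne unfolding d_def by auto
  then obtain F where F: "\<And>m. F m \<in> mono_l2 k" "\<And>m. ?\<Phi> (F m) < d + 1 / real (Suc m)"
    by metis
  have close: "(F m i - F n i)\<^sup>2 \<le> 2 / real (Suc m) + 2 / real (Suc n)" for m n i
  proof -
    let ?a = "\<lambda>i. F m i - p i" and ?b = "\<lambda>i. F n i - F m i"
    have a: "summable (\<lambda>i. (?a i)\<^sup>2)" and b: "summable (\<lambda>i. (?b i)\<^sup>2)"
      using sm [OF F(1)] F(1) [of n] F(1) [of m] summable_square_add_scaled [of "F n" "F m" "-1"]
      by (simp_all add: mono_l2_def)
    have "d \<le> ?\<Phi> (\<lambda>i. F m i + (1/2) * ?b i)"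
      by (intro d_le mono_l2_convex_midpoint F)
    also have "\<dots> = sq_norm2 (\<lambda>i. ?a i + (1/2) * ?b i)"
      by (rule arg_cong [of _ _ sq_norm2]) (simp add: fun_eq_iff)
    also have "\<dots> = ?\<Phi> (F m) + (\<Sum>i. ?a i * ?b i) + sq_norm2 ?b / 4"
      using sq_norm2_add_scaled [OF a b, of "1/2"] by (simp add: power2_eq_square)
    finally have 1: "d \<le> ?\<Phi> (F m) + (\<Sum>i. ?a i * ?b i) + sq_norm2 ?b / 4" .
    have 2: "?\<Phi> (F n) = ?\<Phi> (F m) + 2 * (\<Sum>i. ?a i * ?b i) + sq_norm2 ?b"
      using sq_norm2_add_scaled [OF a b, of 1] by simp
    \<comment> \<open>Eliminating the inner product from \<open>1\<close> and \<open>2\<close>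
      bounds the left side by twice the excess of \<open>?\<Phi> (F m)\<close> over \<open>d\<close>
      plus twice that of \<open>?\<Phi> (F n)\<close>.\<close>
    have "sq_norm2 ?b \<le> 2 / real (Suc m) + 2 / real (Suc n)"
      using 1 2 F(2) [of m] F(2) [of n] by argo
    moreover have "(?b i)\<^sup>2 \<le> sq_norm2 ?b"
      by (rule square_le_sq_norm2 [OF b])
    ultimately show ?thesis
      by (simp add: power2_commute)
  qed
  have "Cauchy (\<lambda>m. F m i)" for i
  proof (rule metric_CauchyI)
    fix e :: real
    assume "e > 0"
    \<comment> \<open>For \<open>m\<close> and \<open>n\<close> at least \<open>M\<close> the
      squared distance is at most \<open>4 / real (Suc M)\<close>, hence the quarter.\<close>
    then obtain M where M: "1 / real (Suc M) < e\<^sup>2 / 4"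
      using nat_approx_posE [of "e\<^sup>2 / 4"] by auto
    show "\<exists>M. \<forall>m\<ge>M. \<forall>n\<ge>M. dist (F m i) (F n i) < e"
    proof (intro exI allI impI)
      fix m n
      assume "m \<ge> M" "n \<ge> M"
      then have "1 / real (Suc m) \<le> 1 / real (Suc M)" "1 / real (Suc n) \<le> 1 / real (Suc M)"
        by (simp_all add: frac_le)
      then have "(F m i - F n i)\<^sup>2 < e\<^sup>2"
        using close [of m i n] M by simp
      then show "dist (F m i) (F n i) < e"
        using \<open>e > 0\<close> abs_le_square_iff [of e "F m i - F n i"] by (simp add: dist_real_def)
    qed
  qed
  then have "\<exists>y. (\<lambda>m. F m i) \<longlonglongrightarrow> y" for i
    using Cauchy_convergent convergent_def by blast
  then obtain f where f: "\<And>i. (\<lambda>m. F m i) \<longlonglongrightarrow> f i"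
    by metis
  have mono: "k_monotone k f"
    unfolding k_monotone_iff_adiff
  proof
    fix i
    show "adiff k f i \<ge> 0"
      by (rule LIMSEQ_le_const [OF tendsto_adiff [OF f]])
        (use F(1) in \<open>auto simp: mono_l2_def k_monotone_iff_adiff\<close>)
  qed
  \<comment> \<open>A Fatou-type bound: pointwise convergence suffices for finite sums, and a bound
    uniform in \<open>N\<close> gives both square-summability and
    \<open>?\<Phi> f \<le> d\<close>.\<close>
  have partial: "(\<Sum>i<N. (f i - p i)\<^sup>2) \<le> d" for N
  proof (rule LIMSEQ_le)
    show "(\<lambda>m. \<Sum>i<N. (F m i - p i)\<^sup>2) \<longlonglongrightarrow> (\<Sum>i<N. (f i - p i)\<^sup>2)"
      by (intro tendsto_intros f)
    have "(\<lambda>m. d + 1 / real (Suc m)) \<longlonglongrightarrow> d + 0"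
      by (intro tendsto_add tendsto_const) (use LIMSEQ_inverse_real_of_nat in \<open>simp add: field_simps\<close>)
    then show "(\<lambda>m. d + 1 / real (Suc m)) \<longlonglongrightarrow> d"
      by simp
    have "(\<Sum>i<N. (F m i - p i)\<^sup>2) \<le> d + 1 / real (Suc m)" for m
      using sum_le_suminf [OF sm [OF F(1)], of "{..<N}" m] F(2) [of m]
      unfolding sq_norm2_def by (simp add: less_imp_le order_trans)
    then show "\<exists>M. \<forall>m\<ge>M. (\<Sum>i<N. (F m i - p i)\<^sup>2) \<le> d + 1 / real (Suc m)"
      by blast
  qed
  have sf: "summable (\<lambda>i. (f i - p i)\<^sup>2)"
    using partial by (intro summableI_nonneg_bounded) auto
  have "summable (\<lambda>i. (f i)\<^sup>2)"
    using summable_square_add_scaled [OF sf p, of 1] by simp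
  with mono have "f \<in> mono_l2 k"
    by (simp add: mono_l2_def)
  moreover have "?\<Phi> f \<le> d"
    unfolding sq_norm2_def using suminf_le_const [OF sf partial] .
  ultimately show thesis
    using that d_le order_trans by blast
qed

section \<open>Optimality conditions from perturbations\<close>

lemma nonneg_of_quadratic_nonneg:
  fixes b c \<delta> :: real
  assumes "\<delta> > 0" "\<And>t. 0 < t \<Longrightarrow> t \<le> \<delta> \<Longrightarrow> 0 \<le> 2 * t * b + t\<^sup>2 * c"
  shows "b \<ge> 0"
proof (rule tendsto_lowerbound)
  \<comment> \<open>Divide the quadratic by \<open>2 * t\<close> and let \<open>t\<close> tend to 0
    from the right.\<close>
  have "((\<lambda>t. b + t / 2 * c) \<longlongrightarrow> b + 0 / 2 * c) (at_right 0)"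
    by (intro tendsto_intros) simp
  then show "((\<lambda>t. b + t / 2 * c) \<longlongrightarrow> b) (at_right 0)"
    by simp
  show "eventually (\<lambda>t. 0 \<le> b + t / 2 * c) (at_right 0)"
    unfolding eventually_at_right_field
  proof (intro exI conjI allI impI)
    fix t
    assume t: "0 < t" "t < \<delta>"
    then have "0 \<le> t * (b + t / 2 * c)"
      using assms(2) [of t] by (simp add: power2_eq_square algebra_simps)
    then show "0 \<le> b + t / 2 * c"
      using t by (simp add: zero_le_mult_iff)
  qed (use assms in auto)
qed auto

text \<open>Assertion (1) for arbitrary \<open>f\<close> and \<open>p\<close>, so that it can be
  applied to the minimiser in \<open>mono_l2\<close> before absolute summability is known.\<close>

definition primitives_dominate :: "nat \<Rightarrow> (nat \<Rightarrow> real) \<Rightarrow> (nat \<Rightarrow> real) \<Rightarrow> bool" where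
  "primitives_dominate k f p \<longleftrightarrow>
     (\<forall>l. primitive k f l \<ge> primitive k p l \<and> (k_knot k f l \<longrightarrow> primitive k f l = primitive k p l))"

lemma primitives_dominate_of_minimiser:
  assumes f: "f \<in> mono_l2 k" and p: "summable (\<lambda>i. (p i)\<^sup>2)"
    and min: "\<And>h. h \<in> mono_l2 k \<Longrightarrow> sq_norm2 (\<lambda>i. f i - p i) \<le> sq_norm2 (\<lambda>i. h i - p i)"
  shows "primitives_dominate k f p"
  unfolding primitives_dominate_def
proof (intro allI conjI impI)
  fix l
  let ?g = "\<lambda>i. f i - p i"
  \<comment> \<open>Only the signed difference at \<open>l\<close> is nonzero, so the pairing of
    \<open>h\<close> with \<open>?g\<close> collapses to \<open>primitive k ?g l\<close>.\<close>
  obtain h where h: "\<forall>i>l. h i = 0" and ah: "adiff k h = (\<lambda>i. of_bool (i = l))"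
    using exists_adiff_eq [of l "\<lambda>i. of_bool (i = l)" k] by auto
  have "h \<in> L1"
    using L1_of_eventually_zero [of "Suc l" h] h by simp
  then have h2: "summable (\<lambda>i. (h i)\<^sup>2)" and h0: "h \<longlonglongrightarrow> 0"
    using summable_square_of_L1 L1_tendsto_0 by auto
  have f2: "summable (\<lambda>i. (f i)\<^sup>2)"
    using f by (simp add: mono_l2_def)
  have g2: "summable (\<lambda>i. (?g i)\<^sup>2)"
    using summable_square_add_scaled [OF f2 p, of "-1"] by simp
  define b where "b = (\<Sum>i. ?g i * h i)"
  have "(\<lambda>i. adiff k h i * primitive k ?g i) sums b"
  proof (rule iterated_sums_by_parts)
    show "k_monotone k h"
      by (simp add: k_monotone_iff_adiff ah)
    show "summable (\<lambda>i. h i * \<bar>?g i\<bar>)"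
      using h2 g2 by (intro summable_mult_of_square) simp_all
    show "(\<lambda>i. h i * ?g i) sums b"
      using summable_sums [OF summable_mult_of_square [OF g2 h2]]
      unfolding b_def by (simp add: mult.commute)
  qed (rule h0)
  moreover have "(\<lambda>i. adiff k h i * primitive k ?g i)
      = (\<lambda>i. if i = l then primitive k ?g i else 0)"
    by (auto simp: ah)
  then have "(\<lambda>i. adiff k h i * primitive k ?g i) sums primitive k ?g l"
    using sums_single [of l "primitive k ?g"] by simp
  ultimately have b: "b = primitive k f l - primitive k p l"
    using sums_unique2 primitive_diff by metis
  \<comment> \<open>Moving by \<open>t\<close> along \<open>h\<close> changes only the signed
    difference at \<open>l\<close>, by \<open>t\<close>. Hence every \<open>t \<ge> 0\<close> is
    admissible, and at a knot also small negative \<open>t\<close>, which gives the reverse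
    inequality.\<close>
  have pert: "0 \<le> 2 * t * b + t\<^sup>2 * sq_norm2 h" if "- adiff k f l \<le> t" for t
  proof -
    have "(\<lambda>i. f i + t * h i) \<in> mono_l2 k"
      using f that summable_square_add_scaled [OF f2 h2, of t]
      by (auto simp: mono_l2_def k_monotone_iff_adiff adiff_add_scaled ah)
    then have "sq_norm2 ?g \<le> sq_norm2 (\<lambda>i. f i + t * h i - p i)"
      by (rule min)
    also have "\<dots> = sq_norm2 (\<lambda>i. ?g i + t * h i)"
      by (simp add: algebra_simps)
    also have "\<dots> = sq_norm2 ?g + 2 * t * b + t\<^sup>2 * sq_norm2 h"
      unfolding b_def by (rule sq_norm2_add_scaled [OF g2 h2])
    finally show ?thesis
      by simp
  qed
  have fl: "adiff k f l \<ge> 0"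
    using f by (simp add: mono_l2_def k_monotone_iff_adiff)
  have "b \<ge> 0"
    by (rule nonneg_of_quadratic_nonneg [of 1 b "sq_norm2 h"]) (use pert fl in auto)
  then show ge: "primitive k f l \<ge> primitive k p l"
    using b by simp
  assume "k_knot k f l"
  then have "adiff k f l > 0"
    by (simp add: k_knot_iff_adiff)
  then have "- b \<ge> 0"
  proof (rule nonneg_of_quadratic_nonneg)
    fix t
    assume "0 < t" "t \<le> adiff k f l"
    then show "0 \<le> 2 * t * (- b) + t\<^sup>2 * sq_norm2 h"
      using pert [of "- t"] by simp
  qed
  then show "primitive k f l = primitive k p l"
    using ge b by simp
qed

section \<open>Finite support of the square-summable minimiser\<close>

lemma L1_of_primitives_dominate:
  assumes f: "f \<in> mono_l2 k" and k: "k \<ge> 1" and p: "\<And>i. i \<ge> N \<Longrightarrow> p i = 0"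
    and dom: "primitives_dominate k f p"
  shows "f \<in> L1"
proof (cases "\<exists>M. f M = 0")
  case True
  then obtain M where M: "f M = 0"
    by blast
  have mono: "k_monotone k f" and lim: "f \<longlonglongrightarrow> 0"
    using f tendsto_zero_of_summable_square by (auto simp: mono_l2_def)
  have dec: "decseq f" and nn: "\<And>i. f i \<ge> 0"
    using decseq_adiff [OF mono lim, of 0] adiff_nonneg [OF mono lim, of 0] k by simp_all
  \<comment> \<open>A nonnegative decreasing sequence stays at 0 once it gets there.\<close>
  have "f i = 0" if "i \<ge> M" for i
    using decseqD [OF dec that] nn [of i] M by linarith
  then show ?thesis
    by (rule L1_of_eventually_zero)
next
  case False
  have mono: "k_monotone k f" and lim: "f \<longlonglongrightarrow> 0"
    using f tendsto_zero_of_summable_square by (auto simp: mono_l2_def)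
  have pos: "f i > 0" for i
    using adiff_nonneg [OF mono lim, of 0 i] False by (auto simp: order_less_le)
  \<comment> \<open>From \<open>N\<close> on, \<open>f - p\<close> equals \<open>f\<close> and is
    positive, so its primitive of order \<open>k\<close> eventually has a strict sign. Knots are
    zeros of that primitive, so none lies beyond \<open>M\<close>.\<close>
  obtain M where M: "\<And>i. i \<ge> M \<Longrightarrow> primitive k (\<lambda>i. f i - p i) i \<noteq> 0"
    using primitive_eventually_pos_or_neg [of N "\<lambda>i. f i - p i" k] p pos by fastforce
  have "adiff k f i = 0" if "i \<ge> M" for i
  proof (rule ccontr)
    assume "adiff k f i \<noteq> 0"
    then have "k_knot k f i"
      using mono by (auto simp: k_knot_iff_adiff k_monotone_iff_adiff order_less_le)
    then show False
      using dom M [OF that] by (simp add: primitives_dominate_def primitive_diff)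
  qed
  then show ?thesis
    using eventually_zero_of_adiff [OF lim] L1_of_eventually_zero by blast
qed

section \<open>Sufficiency of the conditions and uniqueness\<close>

lemma sq_norm2_ge_of_primitives_dominate:
  assumes f: "f \<in> k_monotone_L1 k" and h: "h \<in> k_monotone_L1 k" and p: "p \<in> L1"
    and dom: "primitives_dominate k f p"
  shows "sq_norm2 (\<lambda>i. f i - p i) + sq_norm2 (\<lambda>i. h i - f i) \<le> sq_norm2 (\<lambda>i. h i - p i)"
proof -
  let ?g = "\<lambda>i. f i - p i"
  note sq = summable_square_of_L1
  have sq_f: "summable (\<lambda>i. (f i)\<^sup>2)" and sq_h: "summable (\<lambda>i. (h i)\<^sup>2)"
    using f h sq by (auto simp: k_monotone_L1_def)
  have g: "summable (\<lambda>i. (?g i)\<^sup>2)" and hf: "summable (\<lambda>i. (h i - f i)\<^sup>2)"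
    using summable_square_add_scaled [OF sq_f sq [OF p], of "-1"]
      summable_square_add_scaled [OF sq_h sq_f, of "-1"] by simp_all
  have parts: "(\<lambda>i. adiff k u i * primitive k ?g i) sums (\<Sum>i. ?g i * u i)"
    if "u \<in> k_monotone_L1 k" for u
  proof (rule iterated_sums_by_parts)
    have u: "summable (\<lambda>i. (u i)\<^sup>2)"
      using that sq by (auto simp: k_monotone_L1_def)
    show "k_monotone k u" "u \<longlonglongrightarrow> 0"
      using that L1_tendsto_0 by (auto simp: k_monotone_L1_def)
    show "summable (\<lambda>i. u i * \<bar>?g i\<bar>)"
      using u g by (intro summable_mult_of_square) simp_all
    show "(\<lambda>i. u i * ?g i) sums (\<Sum>i. ?g i * u i)"
      using summable_sums [OF summable_mult_of_square [OF g u]] by (simp add: mult.commute)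
  qed
  have "(\<Sum>i. ?g i * h i) \<ge> 0"
  proof (rule sums_le [OF _ sums_zero parts [OF h]])
    fix i
    show "0 \<le> adiff k h i * primitive k ?g i"
      using h dom
      by (simp add: k_monotone_L1_def k_monotone_iff_adiff primitives_dominate_def primitive_diff)
  qed
  \<comment> \<open>Complementary slackness: at each \<open>i\<close> either the signed difference
    of \<open>f\<close> is 0, or \<open>i\<close> is a knot and the primitive of \<open>?g\<close>
    is 0.\<close>
  moreover have "(\<lambda>i. adiff k f i * primitive k ?g i) = (\<lambda>i. 0)"
    using f dom
    by (auto simp: k_monotone_L1_def k_monotone_iff_adiff primitives_dominate_def primitive_diff
        k_knot_iff_adiff order_less_le fun_eq_iff)
  then have "(\<Sum>i. ?g i * f i) = 0"
    using sums_unique [OF parts [OF f]] by simp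
  moreover have "(\<Sum>i. ?g i * (h i - f i)) = (\<Sum>i. ?g i * h i) - (\<Sum>i. ?g i * f i)"
    using suminf_diff [OF summable_mult_of_square [OF g sq_h] summable_mult_of_square [OF g sq_f]]
    by (simp add: algebra_simps)
  \<comment> \<open>The cross term is nonnegative by the preceding facts. The squared distance from
    \<open>h\<close> to \<open>f\<close> is kept because it yields uniqueness.\<close>
  moreover have "sq_norm2 (\<lambda>i. h i - p i)
      = sq_norm2 ?g + 2 * (\<Sum>i. ?g i * (h i - f i)) + sq_norm2 (\<lambda>i. h i - f i)"
    using sq_norm2_add_scaled [OF g hf, of 1] by simp
  ultimately show ?thesis
    by linarith
qed

lemma arg_min_eq_of_primitives_dominate:
  assumes f: "f \<in> k_monotone_L1 k" and p: "p \<in> L1" and dom: "primitives_dominate k f p"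
  shows "arg_min (\<lambda>f. sq_norm2 (\<lambda>i. f i - p i)) (\<lambda>f. f \<in> k_monotone_L1 k) = f"
    (is "arg_min ?\<Phi> ?P = f")
proof -
  have sm: "summable (\<lambda>i. (h i - f i)\<^sup>2)" if "h \<in> k_monotone_L1 k" for h
    using f that summable_square_add_scaled [of h f "-1"] summable_square_of_L1
    by (simp add: k_monotone_L1_def)
  have "is_arg_min ?\<Phi> ?P f"
    unfolding is_arg_min_def
  proof (intro conjI notI f)
    assume "\<exists>h. h \<in> k_monotone_L1 k \<and> ?\<Phi> h < ?\<Phi> f"
    then obtain h where h: "h \<in> k_monotone_L1 k" "?\<Phi> h < ?\<Phi> f"
      by blast
    then show False
      using sq_norm2_ge_of_primitives_dominate [OF f h(1) p dom] sq_norm2_nonneg [OF sm [OF h(1)]]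
      by linarith
  qed
  \<comment> \<open>\<open>arg_min\<close> is a choice operator, so its value is known to be a
    minimiser only once some minimiser is exhibited, here \<open>f\<close>.\<close>
  then have "is_arg_min ?\<Phi> ?P (arg_min ?\<Phi> ?P)"
    unfolding arg_min_def by (rule someI [where P = "is_arg_min ?\<Phi> ?P"])
  then have m: "arg_min ?\<Phi> ?P \<in> k_monotone_L1 k" and le: "?\<Phi> (arg_min ?\<Phi> ?P) \<le> ?\<Phi> f"
    using f by (auto simp: is_arg_min_def not_less)
  show ?thesis
  proof
    fix i
    have "(arg_min ?\<Phi> ?P i - f i)\<^sup>2 \<le> sq_norm2 (\<lambda>i. arg_min ?\<Phi> ?P i - f i)"
      by (rule square_le_sq_norm2 [OF sm [OF m]])
    also have "\<dots> \<le> 0"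
      using sq_norm2_ge_of_primitives_dominate [OF f m p dom] le by linarith
    finally show "arg_min ?\<Phi> ?P i = f i"
      by simp
  qed
qed

section \<open>The equivalence for finitely supported data\<close>

theorem primitives_dominate_iff_arg_min:
  assumes "k \<ge> 1" "f \<in> k_monotone_L1 k" and p: "\<And>i. i \<ge> N \<Longrightarrow> p i = 0"
  shows "primitives_dominate k f p \<longleftrightarrow>
    f = arg_min (\<lambda>f. sq_norm2 (\<lambda>i. f i - p i)) (\<lambda>f. f \<in> k_monotone_L1 k)"
proof -
  have "p \<in> L1"
    using p by (rule L1_of_eventually_zero)
  note p2 = summable_square_of_L1 [OF this]
  obtain f0 where f0: "f0 \<in> mono_l2 k"
    and min: "\<And>h. h \<in> mono_l2 k \<Longrightarrow> sq_norm2 (\<lambda>i. f0 i - p i) \<le> sq_norm2 (\<lambda>i. h i - p i)"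
    using exists_minimiser_mono_l2 [OF p2, of k] by blast
  have dom0: "primitives_dominate k f0 p"
    by (rule primitives_dominate_of_minimiser [OF f0 p2 min])
  have "f0 \<in> k_monotone_L1 k"
    using f0 L1_of_primitives_dominate [OF f0 assms(1) p dom0]
    by (simp add: k_monotone_L1_def mono_l2_def)
  \<comment> \<open>For the converse, \<open>f0\<close> satisfies the conditions and lies in the
    cone, so \<open>arg_min\<close> returns \<open>f0\<close>; a sequence equal to
    \<open>arg_min\<close> is therefore \<open>f0\<close> and inherits them.\<close>
  then show ?thesis
    using arg_min_eq_of_primitives_dominate \<open>p \<in> L1\<close> dom0 assms(2) by metis
qed

text \<open>The observations are natural numbers, so their sum bounds each of them.\<close>

lemma empirical_pmf_eventually_zero:
  assumes "j \<ge> Suc (\<Sum>i=1..n. x i)"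
  shows "empirical_pmf n x j = 0"
proof -
  have "x i \<noteq> j" if "i \<in> {1..n}" for i
    using member_le_sum [OF that, of x] assms by auto
  then show ?thesis
    by (simp add: empirical_pmf_def)
qed

theorem mainTheorem7:
  fixes M :: "'w measure" and X :: "nat \<Rightarrow> 'w \<Rightarrow> nat" and \<omega> :: 'w
    and k n :: nat and f :: "nat \<Rightarrow> real"
  assumes "prob_space M"
    and "n \<ge> 1"
    and "prob_space.indep_vars M (\<lambda>_. count_space UNIV) X {1..n}"
    and "\<And>i j. i \<in> {1..n} \<Longrightarrow> j \<in> {1..n} \<Longrightarrow>
           distr M (count_space UNIV) (X i) = distr M (count_space UNIV) (X j)"
    and "\<omega> \<in> space M"
    and "k \<ge> 2"
    and "f \<in> L1"
    and "k_monotone k f"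
  shows "(\<forall>l. primitive k f l \<ge> primitive k (empirical_pmf n (\<lambda>i. X i \<omega>)) l \<and>
              (k_knot k f l \<longrightarrow>
                 primitive k f l = primitive k (empirical_pmf n (\<lambda>i. X i \<omega>)) l))
         \<longleftrightarrow> f = LS_estimator k n (\<lambda>i. X i \<omega>)"
proof -
  have "k \<ge> 1" "f \<in> k_monotone_L1 k"
    using assms(6-8) by (simp_all add: k_monotone_L1_def)
  \<comment> \<open>At the fixed outcome the empirical mass function is one finitely supported
    sequence.\<close>
  from primitives_dominate_iff_arg_min [OF this empirical_pmf_eventually_zero]
  show ?thesis
    unfolding primitives_dominate_def LS_estimator_def .
qed

end
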